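(* Let $(T,\mu,\eta,c,u)$ be an affine monad on a gs-monoidal category $\mathcal{C}$. If $\mathcal{C}$ has projections, then so does the Kleisli category $\mathcal{C}_T$.
   Context: Coherence isomorphisms of monoidal structures are suppressed; $\gamma$ denotes the braiding. A gs-monoidal category is a symmetric monoidal category $(\mathcal{C},\otimes,I)$ together with, for every object $X$, arrows $\nabla_X\colon X\to X\otimes X$ and $!_X\colon X\to I$ making $X$ a commutative comonoid, with $\nabla_{X\otimes Y}=(\mathrm{id}_X\otimes\gamma_{X,Y}\otimes\mathrm{id}_Y)\circ(\nabla_X\otimes\nabla_Y)$, $\nabla_I=\mathrm{id}_I$, $!_{X\otimes Y}=\,!_X\otimes !_Y$, $!_I=\mathrm{id}_I$ (no naturality required). It has projections if $!$ is natural, i.e. $!_Y\circ f=\,!_X$ for every $f\colon X\to Y$. A symmetric monoidal monad $(T,\mu,\eta,c,u)$ on a symmetric monoidal category $\mathcal{C}$ is a monad $(T,\mu,\eta)$ together with a lax symmetric monoidal structure on $T$ given by $c_{X,Y}\colon TX\otimes TY\to T(X\otimes Y)$ (natural) and $u\colon I\to TI$, such that $u=\eta_I$, $c_{X,Y}\circ(\eta_X\otimes\eta_Y)=\eta_{X\otimes Y}$, and $\mu_{X\otimes Y}\circ T(c_{X,Y})\circ c_{TX,TY}=c_{X,Y}\circ(\mu_X\otimes\mu_Y)$. On a gs-monoidal category, such a monad is affine if $T(!_X)=u\circ !_{TX}$ for all objects $X$. The Kleisli category $\mathcal{C}_T$ is regarded as a gs-monoidal category with: $X\otimes^\sharp Y:=X\otimes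 Y$ on objects; $f\otimes^\sharp g:=c_{X',Y'}\circ(f\otimes g)$ for Kleisli arrows $f\colon X\to TX'$, $g\colon Y\to TY'$; unit $I$; structural isomorphisms those of $\mathcal{C}$ postcomposed with $\eta$; $\nabla^\sharp_X:=\eta_{X\otimes X}\circ\nabla_X$ and $!^\sharp_X:=\eta_I\circ !_X$. *)

theory Defs
  imports Main
begin

section \<open>Categories\<close>

record ('o, 'a) cat_data =
  Obj :: "'o set"
  Arr :: "'a set"
  Dom :: "'a \<Rightarrow> 'o"
  Cod :: "'a \<Rightarrow> 'o"
  Ident :: "'o \<Rightarrow> 'a"  ("ident\<index>")
  Comp :: "'a \<Rightarrow> 'a \<Rightarrow> 'a"  (infixr "\<cdot>\<index>" 70)

definition hom :: "('o, 'a, 'm) cat_data_scheme \<Rightarrow> 'o \<Rightarrow> 'o \<Rightarrow> 'a set"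
  where "hom C X Y = {f \<in> Arr C. Dom C f = X \<and> Cod C f = Y}"

locale category =
  fixes C :: "('o, 'a, 'm) cat_data_scheme" (structure)
  assumes dom_obj: "f \<in> Arr C \<Longrightarrow> Dom C f \<in> Obj C"
    and cod_obj: "f \<in> Arr C \<Longrightarrow> Cod C f \<in> Obj C"
    and ident_hom: "X \<in> Obj C \<Longrightarrow> ident X \<in> hom C X X"
    and comp_hom: "f \<in> hom C X Y \<Longrightarrow> g \<in> hom C Y Z \<Longrightarrow> g \<cdot> f \<in> hom C X Z"
    and comp_ident_left: "f \<in> hom C X Y \<Longrightarrow> ident Y \<cdot> f = f"
    and comp_ident_right: "f \<in> hom C X Y \<Longrightarrow> f \<cdot> ident X = f"
    and comp_assoc: "f \<in> hom C W X \<Longrightarrow> g \<in> hom C X Y \<Longrightarrow> h \<in> hom C Y Z \<Longrightarrow>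
      (h \<cdot> g) \<cdot> f = h \<cdot> (g \<cdot> f)"

definition inverse_arrows :: "('o, 'a, 'm) cat_data_scheme \<Rightarrow> 'a \<Rightarrow> 'a \<Rightarrow> bool"
  where "inverse_arrows C f g \<longleftrightarrow>
    f \<in> Arr C \<and> g \<in> hom C (Cod C f) (Dom C f) \<and>
    g \<cdot>\<^bsub>C\<^esub> f = ident\<^bsub>C\<^esub> (Dom C f) \<and> f \<cdot>\<^bsub>C\<^esub> g = ident\<^bsub>C\<^esub> (Cod C f)"

definition iso_arrow :: "('o, 'a, 'm) cat_data_scheme \<Rightarrow> 'a \<Rightarrow> bool"
  where "iso_arrow C f \<longleftrightarrow> (\<exists>g. inverse_arrows C f g)"

definition inv_arrow :: "('o, 'a, 'm) cat_data_scheme \<Rightarrow> 'a \<Rightarrow> 'a"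
  where "inv_arrow C f = (THE g. inverse_arrows C f g)"


section \<open>Symmetric monoidal categories\<close>

text \<open>The tensor product is written \<open>\<otimes>\<close> on objects and \<open>\<boxtimes>\<close> on arrows.\<close>

record ('o, 'a) sym_mon_data = "('o, 'a) cat_data" +
  TensorO :: "'o \<Rightarrow> 'o \<Rightarrow> 'o"  (infixr "\<otimes>\<index>" 75)
  TensorA :: "'a \<Rightarrow> 'a \<Rightarrow> 'a"  (infixr "\<boxtimes>\<index>" 75)
  Unit :: "'o"  ("\<one>\<index>")
  Assoc :: "'o \<Rightarrow> 'o \<Rightarrow> 'o \<Rightarrow> 'a"  ("\<alpha>\<index>")
  LUnit :: "'o \<Rightarrow> 'a"  ("lunit\<index>")
  RUnit :: "'o \<Rightarrow> 'a"  ("runit\<index>")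
  Braid :: "'o \<Rightarrow> 'o \<Rightarrow> 'a"  ("\<gamma>\<index>")

locale sym_mon_category = category C
  for C :: "('o, 'a, 'm) sym_mon_data_scheme" (structure) +
  assumes tensor_obj: "X \<in> Obj C \<Longrightarrow> Y \<in> Obj C \<Longrightarrow> X \<otimes> Y \<in> Obj C"
    and unit_obj: "\<one> \<in> Obj C"
    and tensor_hom: "f \<in> hom C X X' \<Longrightarrow> g \<in> hom C Y Y' \<Longrightarrow> f \<boxtimes> g \<in> hom C (X \<otimes> Y) (X' \<otimes> Y')"
    and tensor_ident: "X \<in> Obj C \<Longrightarrow> Y \<in> Obj C \<Longrightarrow> ident X \<boxtimes> ident Y = ident (X \<otimes> Y)"
    and tensor_comp: "f \<in> hom C X X' \<Longrightarrow> f' \<in> hom C X' X'' \<Longrightarrow>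
      g \<in> hom C Y Y' \<Longrightarrow> g' \<in> hom C Y' Y'' \<Longrightarrow>
      (f' \<cdot> f) \<boxtimes> (g' \<cdot> g) = (f' \<boxtimes> g') \<cdot> (f \<boxtimes> g)"
    and assoc_hom: "X \<in> Obj C \<Longrightarrow> Y \<in> Obj C \<Longrightarrow> Z \<in> Obj C \<Longrightarrow>
      \<alpha> X Y Z \<in> hom C ((X \<otimes> Y) \<otimes> Z) (X \<otimes> (Y \<otimes> Z))"
    and assoc_iso: "X \<in> Obj C \<Longrightarrow> Y \<in> Obj C \<Longrightarrow> Z \<in> Obj C \<Longrightarrow> iso_arrow C (\<alpha> X Y Z)"
    and assoc_natural: "f \<in> hom C X X' \<Longrightarrow> g \<in> hom C Y Y' \<Longrightarrow> h \<in> hom C Z Z' \<Longrightarrow>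
      \<alpha> X' Y' Z' \<cdot> ((f \<boxtimes> g) \<boxtimes> h) = (f \<boxtimes> (g \<boxtimes> h)) \<cdot> \<alpha> X Y Z"
    and lunit_hom: "X \<in> Obj C \<Longrightarrow> lunit X \<in> hom C (\<one> \<otimes> X) X"
    and lunit_iso: "X \<in> Obj C \<Longrightarrow> iso_arrow C (lunit X)"
    and lunit_natural: "f \<in> hom C X Y \<Longrightarrow> lunit Y \<cdot> (ident \<one> \<boxtimes> f) = f \<cdot> lunit X"
    and runit_hom: "X \<in> Obj C \<Longrightarrow> runit X \<in> hom C (X \<otimes> \<one>) X"
    and runit_iso: "X \<in> Obj C \<Longrightarrow> iso_arrow C (runit X)"
    and runit_natural: "f \<in> hom C X Y \<Longrightarrow> runit Y \<cdot> (f \<boxtimes> ident \<one>) = f \<cdot> runit X"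
    and pentagon: "W \<in> Obj C \<Longrightarrow> X \<in> Obj C \<Longrightarrow> Y \<in> Obj C \<Longrightarrow> Z \<in> Obj C \<Longrightarrow>
      \<alpha> W X (Y \<otimes> Z) \<cdot> \<alpha> (W \<otimes> X) Y Z =
      (ident W \<boxtimes> \<alpha> X Y Z) \<cdot> \<alpha> W (X \<otimes> Y) Z \<cdot> (\<alpha> W X Y \<boxtimes> ident Z)"
    and triangle: "X \<in> Obj C \<Longrightarrow> Y \<in> Obj C \<Longrightarrow>
      (ident X \<boxtimes> lunit Y) \<cdot> \<alpha> X \<one> Y = runit X \<boxtimes> ident Y"
    and braid_hom: "X \<in> Obj C \<Longrightarrow> Y \<in> Obj C \<Longrightarrow> \<gamma> X Y \<in> hom C (X \<otimes> Y) (Y \<otimes> X)"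
    and braid_natural: "f \<in> hom C X X' \<Longrightarrow> g \<in> hom C Y Y' \<Longrightarrow>
      \<gamma> X' Y' \<cdot> (f \<boxtimes> g) = (g \<boxtimes> f) \<cdot> \<gamma> X Y"
    and braid_symmetric: "X \<in> Obj C \<Longrightarrow> Y \<in> Obj C \<Longrightarrow> \<gamma> Y X \<cdot> \<gamma> X Y = ident (X \<otimes> Y)"
    and hexagon: "X \<in> Obj C \<Longrightarrow> Y \<in> Obj C \<Longrightarrow> Z \<in> Obj C \<Longrightarrow>
      \<alpha> Y Z X \<cdot> \<gamma> X (Y \<otimes> Z) \<cdot> \<alpha> X Y Z =
      (ident Y \<boxtimes> \<gamma> X Z) \<cdot> \<alpha> Y X Z \<cdot> (\<gamma> X Y \<boxtimes> ident Z)"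

text \<open>\<open>id \<otimes> \<gamma> \<otimes> id\<close> from \<open>(X \<otimes> X) \<otimes> (Y \<otimes> Y)\<close> to \<open>(X \<otimes> Y) \<otimes> (X \<otimes> Y)\<close>, with the associators made explicit.\<close>

definition middle_swap :: "('o, 'a, 'm) sym_mon_data_scheme \<Rightarrow> 'o \<Rightarrow> 'o \<Rightarrow> 'a"
  where "middle_swap C X Y =
    inv_arrow C (\<alpha>\<^bsub>C\<^esub> X Y (X \<otimes>\<^bsub>C\<^esub> Y)) \<cdot>\<^bsub>C\<^esub>
    (ident\<^bsub>C\<^esub> X \<boxtimes>\<^bsub>C\<^esub>
      (\<alpha>\<^bsub>C\<^esub> Y X Y \<cdot>\<^bsub>C\<^esub> (\<gamma>\<^bsub>C\<^esub> X Y \<boxtimes>\<^bsub>C\<^esub> ident\<^bsub>C\<^esub> Y) \<cdot>\<^bsub>C\<^esub> inv_arrow C (\<alpha>\<^bsub>C\<^esub> X Y Y))) \<cdot>\<^bsub>C\<^esub>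
    \<alpha>\<^bsub>C\<^esub> X X (Y \<otimes>\<^bsub>C\<^esub> Y)"


section \<open>Gs-monoidal categories\<close>

record ('o, 'a) gs_mon_data = "('o, 'a) sym_mon_data" +
  Dup :: "'o \<Rightarrow> 'a"  ("\<nabla>\<index>")
  Disch :: "'o \<Rightarrow> 'a"  ("bang\<index>")

text \<open>The equations for the unit and for the tensor product of two objects typecheck
  only up to \<open>\<one> \<otimes> \<one> \<cong> \<one>\<close>; this is the unitor at \<open>\<one>\<close> below.\<close>

locale gs_mon_category = sym_mon_category C
  for C :: "('o, 'a, 'm) gs_mon_data_scheme" (structure) +
  assumes dup_hom: "X \<in> Obj C \<Longrightarrow> \<nabla> X \<in> hom C X (X \<otimes> X)"
    and disch_hom: "X \<in> Obj C \<Longrightarrow> bang X \<in> hom C X \<one>"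
    and dup_coassoc: "X \<in> Obj C \<Longrightarrow>
      \<alpha> X X X \<cdot> (\<nabla> X \<boxtimes> ident X) \<cdot> \<nabla> X = (ident X \<boxtimes> \<nabla> X) \<cdot> \<nabla> X"
    and dup_counit_left: "X \<in> Obj C \<Longrightarrow> lunit X \<cdot> (bang X \<boxtimes> ident X) \<cdot> \<nabla> X = ident X"
    and dup_counit_right: "X \<in> Obj C \<Longrightarrow> runit X \<cdot> (ident X \<boxtimes> bang X) \<cdot> \<nabla> X = ident X"
    and dup_commutative: "X \<in> Obj C \<Longrightarrow> \<gamma> X X \<cdot> \<nabla> X = \<nabla> X"
    and dup_tensor: "X \<in> Obj C \<Longrightarrow> Y \<in> Obj C \<Longrightarrow>
      \<nabla> (X \<otimes> Y) = middle_swap C X Y \<cdot> (\<nabla> X \<boxtimes> \<nabla> Y)"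
    and dup_unit: "\<nabla> \<one> = inv_arrow C (lunit \<one>)"
    and disch_tensor: "X \<in> Obj C \<Longrightarrow> Y \<in> Obj C \<Longrightarrow> bang (X \<otimes> Y) = lunit \<one> \<cdot> (bang X \<boxtimes> bang Y)"
    and disch_unit: "bang \<one> = ident \<one>"

locale has_projections = gs_mon_category C
  for C :: "('o, 'a, 'm) gs_mon_data_scheme" (structure) +
  assumes disch_natural: "f \<in> hom C X Y \<Longrightarrow> bang Y \<cdot> f = bang X"


section \<open>Symmetric monoidal monads\<close>

text \<open>\<open>T\<close> is the object part and \<open>TA\<close> the arrow part of the functor.\<close>

locale sym_mon_monad = sym_mon_category C
  for C :: "('o, 'a, 'm) sym_mon_data_scheme" (structure) +
  fixes T :: "'o \<Rightarrow> 'o" and TA :: "'a \<Rightarrow> 'a"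
    and \<mu> :: "'o \<Rightarrow> 'a" and \<eta> :: "'o \<Rightarrow> 'a"
    and c :: "'o \<Rightarrow> 'o \<Rightarrow> 'a" and u :: "'a"
  assumes T_obj: "X \<in> Obj C \<Longrightarrow> T X \<in> Obj C"
    and T_hom: "f \<in> hom C X Y \<Longrightarrow> TA f \<in> hom C (T X) (T Y)"
    and T_ident: "X \<in> Obj C \<Longrightarrow> TA (ident X) = ident (T X)"
    and T_comp: "f \<in> hom C X Y \<Longrightarrow> g \<in> hom C Y Z \<Longrightarrow> TA (g \<cdot> f) = TA g \<cdot> TA f"
    and mu_hom: "X \<in> Obj C \<Longrightarrow> \<mu> X \<in> hom C (T (T X)) (T X)"
    and mu_natural: "f \<in> hom C X Y \<Longrightarrow> \<mu> Y \<cdot> TA (TA f) = TA f \<cdot> \<mu> X"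
    and eta_hom: "X \<in> Obj C \<Longrightarrow> \<eta> X \<in> hom C X (T X)"
    and eta_natural: "f \<in> hom C X Y \<Longrightarrow> \<eta> Y \<cdot> f = TA f \<cdot> \<eta> X"
    and mu_assoc: "X \<in> Obj C \<Longrightarrow> \<mu> X \<cdot> TA (\<mu> X) = \<mu> X \<cdot> \<mu> (T X)"
    and mu_eta_left: "X \<in> Obj C \<Longrightarrow> \<mu> X \<cdot> \<eta> (T X) = ident (T X)"
    and mu_eta_right: "X \<in> Obj C \<Longrightarrow> \<mu> X \<cdot> TA (\<eta> X) = ident (T X)"
    and c_hom: "X \<in> Obj C \<Longrightarrow> Y \<in> Obj C \<Longrightarrow> c X Y \<in> hom C (T X \<otimes> T Y) (T (X \<otimes> Y))"
    and c_natural: "f \<in> hom C X X' \<Longrightarrow> g \<in> hom C Y Y' \<Longrightarrow>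
      c X' Y' \<cdot> (TA f \<boxtimes> TA g) = TA (f \<boxtimes> g) \<cdot> c X Y"
    and u_hom: "u \<in> hom C \<one> (T \<one>)"
    and c_assoc: "X \<in> Obj C \<Longrightarrow> Y \<in> Obj C \<Longrightarrow> Z \<in> Obj C \<Longrightarrow>
      TA (\<alpha> X Y Z) \<cdot> c (X \<otimes> Y) Z \<cdot> (c X Y \<boxtimes> ident (T Z)) =
      c X (Y \<otimes> Z) \<cdot> (ident (T X) \<boxtimes> c Y Z) \<cdot> \<alpha> (T X) (T Y) (T Z)"
    and c_unit_left: "X \<in> Obj C \<Longrightarrow>
      TA (lunit X) \<cdot> c \<one> X \<cdot> (u \<boxtimes> ident (T X)) = lunit (T X)"
    and c_unit_right: "X \<in> Obj C \<Longrightarrow>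
      TA (runit X) \<cdot> c X \<one> \<cdot> (ident (T X) \<boxtimes> u) = runit (T X)"
    and c_braid: "X \<in> Obj C \<Longrightarrow> Y \<in> Obj C \<Longrightarrow>
      TA (\<gamma> X Y) \<cdot> c X Y = c Y X \<cdot> \<gamma> (T X) (T Y)"
    and u_eta: "u = \<eta> \<one>"
    and c_eta: "X \<in> Obj C \<Longrightarrow> Y \<in> Obj C \<Longrightarrow> c X Y \<cdot> (\<eta> X \<boxtimes> \<eta> Y) = \<eta> (X \<otimes> Y)"
    and c_mu: "X \<in> Obj C \<Longrightarrow> Y \<in> Obj C \<Longrightarrow>
      \<mu> (X \<otimes> Y) \<cdot> TA (c X Y) \<cdot> c (T X) (T Y) = c X Y \<cdot> (\<mu> X \<boxtimes> \<mu> Y)"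

locale affine_monad = gs_mon_category C + sym_mon_monad C T TA \<mu> \<eta> c u
  for C :: "('o, 'a, 'm) gs_mon_data_scheme" (structure) and T TA \<mu> \<eta> c u +
  assumes affine: "X \<in> Obj C \<Longrightarrow> TA (bang X) = u \<cdot> bang (T X)"


section \<open>The Kleisli category\<close>

text \<open>A Kleisli arrow from \<open>X\<close> to \<open>Y\<close> is an arrow \<open>f\<close> of \<open>C\<close> from \<open>X\<close> to \<open>T Y\<close>. It is
  encoded as the pair \<open>(f, Y)\<close>: since \<open>T\<close> need not be injective on objects, \<open>f\<close> alone
  does not determine \<open>Y\<close>.\<close>

definition kleisli_pure ::
  "('o, 'a, 'm) cat_data_scheme \<Rightarrow> ('o \<Rightarrow> 'a) \<Rightarrow> 'a \<Rightarrow> 'a \<times> 'o"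
  where "kleisli_pure C \<eta> f = (\<eta> (Cod C f) \<cdot>\<^bsub>C\<^esub> f, Cod C f)"

definition kleisli ::
  "('o, 'a, 'm) gs_mon_data_scheme \<Rightarrow> ('o \<Rightarrow> 'o) \<Rightarrow> ('a \<Rightarrow> 'a) \<Rightarrow> ('o \<Rightarrow> 'a) \<Rightarrow>
    ('o \<Rightarrow> 'a) \<Rightarrow> ('o \<Rightarrow> 'o \<Rightarrow> 'a) \<Rightarrow> ('o, 'a \<times> 'o) gs_mon_data"
  where "kleisli C T TA \<mu> \<eta> c = \<lparr>
    Obj = Obj C,
    Arr = {(f, Y). f \<in> Arr C \<and> Y \<in> Obj C \<and> Cod C f = T Y},
    Dom = \<lambda>(f, Y). Dom C f,
    Cod = \<lambda>(f, Y). Y,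
    Ident = \<lambda>X. (\<eta> X, X),
    Comp = \<lambda>(g, Z) (f, Y). (\<mu> Z \<cdot>\<^bsub>C\<^esub> TA g \<cdot>\<^bsub>C\<^esub> f, Z),
    TensorO = TensorO C,
    TensorA = \<lambda>(f, X') (g, Y'). (c X' Y' \<cdot>\<^bsub>C\<^esub> (f \<boxtimes>\<^bsub>C\<^esub> g), X' \<otimes>\<^bsub>C\<^esub> Y'),
    Unit = Unit C,
    Assoc = \<lambda>X Y Z. kleisli_pure C \<eta> (\<alpha>\<^bsub>C\<^esub> X Y Z),
    LUnit = \<lambda>X. kleisli_pure C \<eta> (lunit\<^bsub>C\<^esub> X),
    RUnit = \<lambda>X. kleisli_pure C \<eta> (runit\<^bsub>C\<^esub> X),
    Braid = \<lambda>X Y. kleisli_pure C \<eta> (\<gamma>\<^bsub>C\<^esub> X Y),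
    Dup = \<lambda>X. kleisli_pure C \<eta> (\<nabla>\<^bsub>C\<^esub> X),
    Disch = \<lambda>X. kleisli_pure C \<eta> (bang\<^bsub>C\<^esub> X)\<rparr>"

end

theory Submission
  imports Defs
begin

text \<open>Two things have to be shown: the Kleisli category \<open>K\<close> is gs-monoidal, and its discharger is
  natural. The second is where affineness enters. For a Kleisli arrow \<open>f\<close> from \<open>X\<close> to \<open>T Y\<close>, the
  composite of \<open>f\<close> with the discharger of \<open>K\<close> at \<open>Y\<close> is \<open>TA (bang Y) \<cdot> f\<close>; affineness turns
  this into \<open>u \<cdot> bang (T Y) \<cdot> f\<close>, and naturality of \<open>bang\<close> in \<open>C\<close> into
  \<open>u \<cdot> bang X = \<eta> \<one> \<cdot> bang X\<close>, the discharger of \<open>K\<close> at \<open>X\<close>.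

  The first holds for every symmetric monoidal monad on a gs-monoidal category. Postcomposition with
  \<open>\<eta>\<close> is an identity-on-objects functor \<open>J\<close> from \<open>C\<close> to \<open>K\<close> (\<open>pure_comp\<close>), and it is strictly
  monoidal because \<open>\<eta>\<close> is a monoidal transformation (\<open>pure_tensor\<close>). The structural arrows of \<open>K\<close>,
  the comonoids included, are by definition the images under \<open>J\<close> of those of \<open>C\<close>. Each axiom
  that mentions only structural arrows (pentagon, triangle, hexagon, all comonoid laws) is therefore
  the image of the same axiom in \<open>C\<close>; the inverses occurring in some of them are carried along
  since functors preserve inverses (\<open>kleisli_inv_arrow\<close>). Only the axioms that quantify over
  arbitrary Kleisli arrows need the finer structure of \<open>T\<close>: functoriality of the tensor is the
  compatibility of \<open>\<mu>\<close> with \<open>c\<close> (\<open>kleisli_tensor_comp\<close>), and naturality of the associator,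
  unitors and braiding is the coherence of the lax monoidal structure \<open>(c, u)\<close>.\<close>


section \<open>Arrows by domain and codomain\<close>

context category
begin

text \<open>The axioms are stated with hom-sets, whose objects rewriting would have to guess. The rules
  with suffix \<open>seq\<close> say the same in terms of \<open>Arr\<close>, \<open>Dom\<close> and \<open>Cod\<close>, so that the composability
  side conditions are themselves discharged by rewriting.\<close>

lemma homD:
  assumes "f \<in> hom C X Y"
  shows "f \<in> Arr C" "Dom C f = X" "Cod C f = Y" "X \<in> Obj C" "Y \<in> Obj C"
  using assms dom_obj cod_obj by (auto simp: hom_def)

lemma ident_seq [simp]:
  assumes "X \<in> Obj C"
  shows "ident X \<in> Arr C" "Dom C (ident X) = X" "Cod C (ident X) = X"
  using homD[OF ident_hom[OF assms]] by simp_all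

lemma comp_seq [simp]:
  assumes "f \<in> Arr C" "g \<in> Arr C" "Dom C g = Cod C f"
  shows "g \<cdot> f \<in> Arr C" "Dom C (g \<cdot> f) = Dom C f" "Cod C (g \<cdot> f) = Cod C g"
  using homD[OF comp_hom[of f "Dom C f" "Cod C f" g "Cod C g"]] assms by (simp_all add: hom_def)

lemma comp_assoc_seq:
  assumes "f \<in> Arr C" "g \<in> Arr C" "h \<in> Arr C" "Dom C g = Cod C f" "Dom C h = Cod C g"
  shows "(h \<cdot> g) \<cdot> f = h \<cdot> g \<cdot> f"
  using comp_assoc[of f "Dom C f" "Cod C f" g "Cod C g" h "Cod C h"] assms by (simp add: hom_def)

lemma comp_ident_seq [simp]:
  assumes "f \<in> Arr C"
  shows "Cod C f = X \<Longrightarrow> ident X \<cdot> f = f" "Dom C f = X \<Longrightarrow> f \<cdot> ident X = f"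
  using comp_ident_left[of f] comp_ident_right[of f] assms by (auto simp: hom_def)

lemma inverse_arrows_unique:
  assumes "inverse_arrows C f g" "inverse_arrows C f g'"
  shows "g = g'"
proof -
  have f: "f \<in> Arr C"
    and g: "g \<in> Arr C" "Dom C g = Cod C f" "Cod C g = Dom C f"
      "g \<cdot> f = ident (Dom C f)"
    and g': "g' \<in> Arr C" "Dom C g' = Cod C f" "Cod C g' = Dom C f"
      "f \<cdot> g' = ident (Cod C f)"
    using assms by (auto simp: inverse_arrows_def hom_def)
  have "g = g \<cdot> f \<cdot> g'" using g g' by simp
  also have "\<dots> = (g \<cdot> f) \<cdot> g'" by (rule comp_assoc_seq[symmetric]) (use f g g' in simp_all)
  also have "\<dots> = g'" using g g' by simp
  finally show ?thesis .
qed

lemma inv_arrow_eqI: "inverse_arrows C f g \<Longrightarrow> inv_arrow C f = g"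
  unfolding inv_arrow_def by (blast intro: the_equality inverse_arrows_unique)

lemma inverse_arrows_inv_arrow: "iso_arrow C f \<Longrightarrow> inverse_arrows C f (inv_arrow C f)"
  unfolding iso_arrow_def using inv_arrow_eqI by auto

lemma inv_arrow_seq [simp]:
  assumes "iso_arrow C f"
  shows "inv_arrow C f \<in> Arr C" "Dom C (inv_arrow C f) = Cod C f" "Cod C (inv_arrow C f) = Dom C f"
  using inverse_arrows_inv_arrow[OF assms] by (auto simp: inverse_arrows_def hom_def)

end

context sym_mon_category
begin

lemmas objs [simp] = tensor_obj unit_obj dom_obj cod_obj

lemma tensor_seq [simp]:
  assumes "f \<in> Arr C" "g \<in> Arr C"
  shows "f \<boxtimes> g \<in> Arr C" "Dom C (f \<boxtimes> g) = Dom C f \<otimes> Dom C g"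
    "Cod C (f \<boxtimes> g) = Cod C f \<otimes> Cod C g"
  using homD[OF tensor_hom[of f "Dom C f" "Cod C f" g "Dom C g" "Cod C g"]] assms
  by (simp_all add: hom_def)

lemma interchange:
  assumes "f \<in> Arr C" "f' \<in> Arr C" "g \<in> Arr C" "g' \<in> Arr C"
    "Dom C f' = Cod C f" "Dom C g' = Cod C g"
  shows "(f' \<boxtimes> g') \<cdot> (f \<boxtimes> g) = (f' \<cdot> f) \<boxtimes> (g' \<cdot> g)"
  by (rule tensor_comp[symmetric, of f "Dom C f" "Cod C f" f' "Cod C f'" g "Dom C g" "Cod C g" g' "Cod C g'"])
    (use assms in \<open>simp_all add: hom_def\<close>)

lemma structural_seq [simp]:
  assumes "X \<in> Obj C" "Y \<in> Obj C"
  shows "lunit X \<in> Arr C" "Dom C (lunit X) = \<one> \<otimes> X" "Cod C (lunit X) = X"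
    "runit X \<in> Arr C" "Dom C (runit X) = X \<otimes> \<one>" "Cod C (runit X) = X"
    "\<gamma> X Y \<in> Arr C" "Dom C (\<gamma> X Y) = X \<otimes> Y" "Cod C (\<gamma> X Y) = Y \<otimes> X"
  using homD[OF lunit_hom[OF assms(1)]] homD[OF runit_hom[OF assms(1)]]
    homD[OF braid_hom[OF assms]] by simp_all

lemma assoc_seq [simp]:
  assumes "X \<in> Obj C" "Y \<in> Obj C" "Z \<in> Obj C"
  shows "\<alpha> X Y Z \<in> Arr C" "Dom C (\<alpha> X Y Z) = (X \<otimes> Y) \<otimes> Z" "Cod C (\<alpha> X Y Z) = X \<otimes> Y \<otimes> Z"
  using homD[OF assoc_hom[OF assms]] by simp_all

lemmas isos [simp] = assoc_iso lunit_iso runit_iso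

lemma middle_swap_seq [simp]:
  assumes "X \<in> Obj C" "Y \<in> Obj C"
  shows "middle_swap C X Y \<in> Arr C" "Dom C (middle_swap C X Y) = (X \<otimes> X) \<otimes> Y \<otimes> Y"
    "Cod C (middle_swap C X Y) = (X \<otimes> Y) \<otimes> X \<otimes> Y"
  using assms by (simp_all add: middle_swap_def)

end

lemma (in gs_mon_category) comonoid_seq [simp]:
  assumes "X \<in> Obj C"
  shows "\<nabla> X \<in> Arr C" "Dom C (\<nabla> X) = X" "Cod C (\<nabla> X) = X \<otimes> X"
    "bang X \<in> Arr C" "Dom C (bang X) = X" "Cod C (bang X) = \<one>"
  using homD[OF dup_hom[OF assms]] homD[OF disch_hom[OF assms]] by simp_all

lemma (in sym_mon_monad) monad_seq [simp]:
  shows "X \<in> Obj C \<Longrightarrow> \<mu> X \<in> Arr C" "X \<in> Obj C \<Longrightarrow> Dom C (\<mu> X) = T (T X)"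
    "X \<in> Obj C \<Longrightarrow> Cod C (\<mu> X) = T X"
    "X \<in> Obj C \<Longrightarrow> \<eta> X \<in> Arr C" "X \<in> Obj C \<Longrightarrow> Dom C (\<eta> X) = X"
    "X \<in> Obj C \<Longrightarrow> Cod C (\<eta> X) = T X"
    "X \<in> Obj C \<Longrightarrow> Y \<in> Obj C \<Longrightarrow> c X Y \<in> Arr C"
    "X \<in> Obj C \<Longrightarrow> Y \<in> Obj C \<Longrightarrow> Dom C (c X Y) = T X \<otimes> T Y"
    "X \<in> Obj C \<Longrightarrow> Y \<in> Obj C \<Longrightarrow> Cod C (c X Y) = T (X \<otimes> Y)"
    "f \<in> Arr C \<Longrightarrow> TA f \<in> Arr C" "f \<in> Arr C \<Longrightarrow> Dom C (TA f) = T (Dom C f)"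
    "f \<in> Arr C \<Longrightarrow> Cod C (TA f) = T (Cod C f)"
    "X \<in> Obj C \<Longrightarrow> T X \<in> Obj C"
  using homD[OF mu_hom[of X]] homD[OF eta_hom[of X]] homD[OF c_hom[of X Y]]
    homD[OF T_hom[of f "Dom C f" "Cod C f"]] T_obj
  by (simp_all add: hom_def)

lemma (in sym_mon_monad) T_comp_seq:
  assumes "f \<in> Arr C" "g \<in> Arr C" "Dom C g = Cod C f"
  shows "TA (g \<cdot> f) = TA g \<cdot> TA f"
  using T_comp[of f "Dom C f" "Cod C f" g "Cod C g"] assms by (simp add: hom_def)


section \<open>The inclusion of the base into the Kleisli category\<close>

locale gs_mon_monad = gs_mon_category C + sym_mon_monad C T TA \<mu> \<eta> c u
  for C :: "('o, 'a, 'm) gs_mon_data_scheme" (structure) and T TA \<mu> \<eta> c u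
begin

abbreviation "K \<equiv> kleisli C T TA \<mu> \<eta> c"
abbreviation "J \<equiv> kleisli_pure C \<eta>"

lemma kleisli_simps [simp]:
  "Obj K = Obj C"
  "(f, Y) \<in> Arr K \<longleftrightarrow> f \<in> Arr C \<and> Y \<in> Obj C \<and> Cod C f = T Y"
  "Dom K (f, Y) = Dom C f" "Cod K (f, Y) = Y"
  "X \<otimes>\<^bsub>K\<^esub> Y = X \<otimes> Y"
  "(f, Y) \<boxtimes>\<^bsub>K\<^esub> (g, Z) = (c Y Z \<cdot> (f \<boxtimes> g), Y \<otimes> Z)"
  "\<one>\<^bsub>K\<^esub> = \<one>"
  "\<alpha>\<^bsub>K\<^esub> X Y Z = J (\<alpha> X Y Z)" "lunit\<^bsub>K\<^esub> X = J (lunit X)" "runit\<^bsub>K\<^esub> X = J (runit X)"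
  "\<gamma>\<^bsub>K\<^esub> X Y = J (\<gamma> X Y)" "\<nabla>\<^bsub>K\<^esub> X = J (\<nabla> X)" "bang\<^bsub>K\<^esub> X = J (bang X)"
  by (simp_all add: kleisli_def)

text \<open>Identities and composites of \<open>K\<close> are kept folded by default: the functor laws of \<open>J\<close> and the
  composition rules for pure arrows have to match them.\<close>

lemma kleisli_ident: "Ident K X = (\<eta> X, X)"
  and kleisli_comp: "(g, Z) \<cdot>\<^bsub>K\<^esub> (f, Y) = (\<mu> Z \<cdot> TA g \<cdot> f, Z)"
  by (simp_all add: kleisli_def)

lemma kleisli_hom_iff:
  "F \<in> hom K X Y \<longleftrightarrow> (\<exists>f. F = (f, Y) \<and> f \<in> Arr C \<and> Dom C f = X \<and> Cod C f = T Y \<and> Y \<in> Obj C)"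
  by (cases F) (auto simp: hom_def)

lemma kleisli_homE:
  assumes "F \<in> hom K X Y"
  obtains f where "F = (f, Y)" "f \<in> Arr C" "Dom C f = X" "Cod C f = T Y" "X \<in> Obj C" "Y \<in> Obj C"
  using assms dom_obj by (auto simp: kleisli_hom_iff)

lemma pure_hom: "f \<in> hom C X Y \<Longrightarrow> J f \<in> hom K X Y"
  using cod_obj by (auto simp: kleisli_hom_iff kleisli_pure_def hom_def)

lemma pure_ident: "X \<in> Obj C \<Longrightarrow> J (ident X) = Ident K X"
  by (simp add: kleisli_pure_def kleisli_ident)

text \<open>Composing with a pure arrow involves no multiplication, by the unit laws of the monad:
  on the right it is composition in \<open>C\<close>, on the left it is composition with an arrow of the
  form \<open>TA g\<close>. These two rules reduce most Kleisli computations to computations in \<open>C\<close>.\<close>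

lemma comp_pure_right:
  assumes "f \<in> Arr C" "g \<in> Arr C" "Dom C g = Cod C f" "Cod C g = T Z" "Z \<in> Obj C"
  shows "(g, Z) \<cdot>\<^bsub>K\<^esub> J f = (g \<cdot> f, Z)"
proof -
  have "TA g \<cdot> \<eta> (Cod C f) = \<eta> (T Z) \<cdot> g"
    using eta_natural[of g "Cod C f" "T Z"] assms by (simp add: hom_def)
  then have "TA g \<cdot> \<eta> (Cod C f) \<cdot> f = \<eta> (T Z) \<cdot> g \<cdot> f"
    using assms comp_assoc_seq[of f "\<eta> (Cod C f)" "TA g"] comp_assoc_seq[of f g "\<eta> (T Z)"] by simp
  moreover have "\<mu> Z \<cdot> \<eta> (T Z) \<cdot> g \<cdot> f = g \<cdot> f"
    using assms comp_assoc_seq[of "g \<cdot> f" "\<eta> (T Z)" "\<mu> Z"] mu_eta_left[of Z] by simp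
  ultimately show ?thesis by (simp add: kleisli_pure_def kleisli_comp)
qed

lemma comp_pure_left:
  assumes "f \<in> Arr C" "g \<in> Arr C" "Cod C f = T Y" "Dom C g = Y"
  shows "J g \<cdot>\<^bsub>K\<^esub> (f, Y) = (TA g \<cdot> f, Cod C g)"
proof -
  define Z where "Z = Cod C g"
  have Z: "Z \<in> Obj C" using assms Z_def by simp
  have "\<mu> Z \<cdot> TA (\<eta> Z \<cdot> g) \<cdot> f = ((\<mu> Z \<cdot> TA (\<eta> Z)) \<cdot> TA g) \<cdot> f"
    using assms Z by (simp add: T_comp_seq comp_assoc_seq Z_def)
  also have "\<dots> = TA g \<cdot> f" using assms Z mu_eta_right[of Z] by (simp add: Z_def)
  finally show ?thesis by (simp add: kleisli_pure_def kleisli_comp Z_def)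
qed

lemma pure_comp:
  assumes "f \<in> Arr C" "g \<in> Arr C" "Dom C g = Cod C f"
  shows "J g \<cdot>\<^bsub>K\<^esub> J f = J (g \<cdot> f)"
  using comp_pure_right[of f "\<eta> (Cod C g) \<cdot> g" "Cod C g"] assms
  by (simp add: kleisli_pure_def comp_assoc_seq)

text \<open>Here the monoidality of \<open>\<eta>\<close> is what is needed: \<open>c\<close> combines two units into one.\<close>

lemma pure_tensor:
  assumes "f \<in> Arr C" "g \<in> Arr C"
  shows "J f \<boxtimes>\<^bsub>K\<^esub> J g = J (f \<boxtimes> g)"
proof -
  let ?Y = "Cod C f" and ?Z = "Cod C g"
  have "c ?Y ?Z \<cdot> ((\<eta> ?Y \<cdot> f) \<boxtimes> (\<eta> ?Z \<cdot> g)) = (c ?Y ?Z \<cdot> (\<eta> ?Y \<boxtimes> \<eta> ?Z)) \<cdot> (f \<boxtimes> g)"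
    using assms by (simp add: interchange comp_assoc_seq)
  then show ?thesis using assms by (simp add: kleisli_pure_def c_eta)
qed

lemma pure_inverse_arrows:
  assumes "inverse_arrows C f g"
  shows "inverse_arrows K (J f) (J g)"
proof -
  have f: "f \<in> Arr C" and g: "g \<in> hom C (Cod C f) (Dom C f)"
    and "g \<cdot> f = ident (Dom C f)" "f \<cdot> g = ident (Cod C f)"
    using assms by (auto simp: inverse_arrows_def)
  then have "J g \<cdot>\<^bsub>K\<^esub> J f = Ident K (Dom C f)" "J f \<cdot>\<^bsub>K\<^esub> J g = Ident K (Cod C f)"
    using homD[OF g] by (simp_all add: pure_comp pure_ident)
  moreover have "J f \<in> hom K (Dom C f) (Cod C f)" using f pure_hom by (simp add: hom_def)
  ultimately show ?thesis using pure_hom[OF g] by (simp add: inverse_arrows_def hom_def)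
qed

lemma pure_iso: "iso_arrow C f \<Longrightarrow> iso_arrow K (J f)"
  unfolding iso_arrow_def using pure_inverse_arrows by blast


section \<open>The Kleisli category is gs-monoidal\<close>

lemma kleisli_category: "category K"
proof
  fix F X Y G Z assume "F \<in> hom K X Y" "G \<in> hom K Y Z"
  then obtain f g where "F = (f, Y)" "f \<in> Arr C" "Dom C f = X" "Cod C f = T Y"
     "G = (g, Z)" "g \<in> Arr C" "Dom C g = Y" "Cod C g = T Z" "Y \<in> Obj C" "Z \<in> Obj C"
    by (elim kleisli_homE)
  then show "G \<cdot>\<^bsub>K\<^esub> F \<in> hom K X Z" by (simp add: kleisli_hom_iff kleisli_comp)
next
  fix F X Y assume "F \<in> hom K X Y"
  then obtain f where f: "F = (f, Y)" "f \<in> Arr C" "Dom C f = X" "Cod C f = T Y" "X \<in> Obj C" "Y \<in> Obj C"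
    by (elim kleisli_homE)
  show "Ident K Y \<cdot>\<^bsub>K\<^esub> F = F"
    using comp_pure_left[of f "ident Y" Y] f by (simp add: pure_ident T_ident)
  show "F \<cdot>\<^bsub>K\<^esub> Ident K X = F"
    using comp_pure_right[of "ident X" f Y] f by (simp add: pure_ident)
next
  fix F W X G Y H Z assume "F \<in> hom K W X" "G \<in> hom K X Y" "H \<in> hom K Y Z"
  then obtain f g h where f: "F = (f, X)" "f \<in> Arr C" "Dom C f = W" "Cod C f = T X"
     and g: "G = (g, Y)" "g \<in> Arr C" "Dom C g = X" "Cod C g = T Y"
     and h: "H = (h, Z)" "h \<in> Arr C" "Dom C h = Y" "Cod C h = T Z"
     and o: "X \<in> Obj C" "Y \<in> Obj C" "Z \<in> Obj C"
    by (elim kleisli_homE)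
  have "\<mu> Z \<cdot> TA (\<mu> Z \<cdot> TA h \<cdot> g) \<cdot> f = (\<mu> Z \<cdot> TA (\<mu> Z)) \<cdot> TA (TA h) \<cdot> TA g \<cdot> f"
    using f g h o by (simp add: T_comp_seq comp_assoc_seq)
  also have "\<dots> = \<mu> Z \<cdot> (\<mu> (T Z) \<cdot> TA (TA h)) \<cdot> TA g \<cdot> f"
    using f g h o by (simp add: mu_assoc comp_assoc_seq)
  also have "\<mu> (T Z) \<cdot> TA (TA h) = TA h \<cdot> \<mu> Y"
    using mu_natural[of h Y "T Z"] h by (simp add: hom_def)
  finally show "(H \<cdot>\<^bsub>K\<^esub> G) \<cdot>\<^bsub>K\<^esub> F = H \<cdot>\<^bsub>K\<^esub> (G \<cdot>\<^bsub>K\<^esub> F)"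
    using f g h o by (simp add: kleisli_comp comp_assoc_seq)
qed (auto simp: kleisli_hom_iff kleisli_ident)

lemma kleisli_inv_arrow: "iso_arrow C f \<Longrightarrow> inv_arrow K (J f) = J (inv_arrow C f)"
  by (intro category.inv_arrow_eqI[OF kleisli_category] pure_inverse_arrows inverse_arrows_inv_arrow)

text \<open>Both sides run \<open>f \<boxtimes> g\<close>, then \<open>TA f' \<boxtimes> TA g'\<close>, then flatten. The left side multiplies in each
  factor before combining them by \<open>c\<close>, the right side combines both layers and multiplies once;
  \<open>c_mu\<close> identifies the two once naturality has moved \<open>c\<close> past \<open>TA f' \<boxtimes> TA g'\<close>.\<close>

lemma kleisli_tensor_comp:
  assumes "F \<in> hom K X X'" "F' \<in> hom K X' X''" "G \<in> hom K Y Y'" "G' \<in> hom K Y' Y''"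
  shows "(F' \<cdot>\<^bsub>K\<^esub> F) \<boxtimes>\<^bsub>K\<^esub> (G' \<cdot>\<^bsub>K\<^esub> G) = (F' \<boxtimes>\<^bsub>K\<^esub> G') \<cdot>\<^bsub>K\<^esub> (F \<boxtimes>\<^bsub>K\<^esub> G)"
proof -
  from assms obtain f f' g g' where
    f: "F = (f, X')" "f \<in> Arr C" "Dom C f = X" "Cod C f = T X'"
    and f': "F' = (f', X'')" "f' \<in> Arr C" "Dom C f' = X'" "Cod C f' = T X''"
    and g: "G = (g, Y')" "g \<in> Arr C" "Dom C g = Y" "Cod C g = T Y'"
    and g': "G' = (g', Y'')" "g' \<in> Arr C" "Dom C g' = Y'" "Cod C g' = T Y''"
    and o: "X' \<in> Obj C" "X'' \<in> Obj C" "Y' \<in> Obj C" "Y'' \<in> Obj C"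
    by (elim kleisli_homE)
  note s = f f' g g' o
  have "c X'' Y'' \<cdot> ((\<mu> X'' \<cdot> TA f' \<cdot> f) \<boxtimes> (\<mu> Y'' \<cdot> TA g' \<cdot> g)) =
      (c X'' Y'' \<cdot> (\<mu> X'' \<boxtimes> \<mu> Y'')) \<cdot> (TA f' \<boxtimes> TA g') \<cdot> (f \<boxtimes> g)"
    using s by (simp add: comp_assoc_seq interchange)
  also have "\<dots> = \<mu> (X'' \<otimes> Y'') \<cdot> TA (c X'' Y'') \<cdot> (c (T X'') (T Y'') \<cdot> (TA f' \<boxtimes> TA g')) \<cdot> (f \<boxtimes> g)"
    using s by (simp add: c_mu[symmetric] comp_assoc_seq)
  also have "c (T X'') (T Y'') \<cdot> (TA f' \<boxtimes> TA g') = TA (f' \<boxtimes> g') \<cdot> c X' Y'"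
    using c_natural[of f' X' "T X''" g' Y' "T Y''"] s by (simp add: hom_def)
  finally show ?thesis using s by (simp add: kleisli_comp T_comp_seq comp_assoc_seq)
qed

text \<open>In the four naturality laws below, composition with the structural arrow is free of \<open>\<mu>\<close>.
  What remains is the coherence law that moves the structural arrow through \<open>c\<close>, so that it sits at
  objects of the form \<open>T X'\<close>, and its naturality in \<open>C\<close> at the underlying arrows.\<close>

lemma kleisli_assoc_natural:
  assumes "F \<in> hom K X X'" "G \<in> hom K Y Y'" "H \<in> hom K Z Z'"
  shows "\<alpha>\<^bsub>K\<^esub> X' Y' Z' \<cdot>\<^bsub>K\<^esub> ((F \<boxtimes>\<^bsub>K\<^esub> G) \<boxtimes>\<^bsub>K\<^esub> H) = (F \<boxtimes>\<^bsub>K\<^esub> (G \<boxtimes>\<^bsub>K\<^esub> H)) \<cdot>\<^bsub>K\<^esub> \<alpha>\<^bsub>K\<^esub> X Y Z"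
proof -
  from assms obtain f g h where
    f: "F = (f, X')" "f \<in> Arr C" "Dom C f = X" "Cod C f = T X'"
    and g: "G = (g, Y')" "g \<in> Arr C" "Dom C g = Y" "Cod C g = T Y'"
    and h: "H = (h, Z')" "h \<in> Arr C" "Dom C h = Z" "Cod C h = T Z'"
    and o: "X \<in> Obj C" "X' \<in> Obj C" "Y \<in> Obj C" "Y' \<in> Obj C" "Z \<in> Obj C" "Z' \<in> Obj C"
    by (elim kleisli_homE)
  note s = f g h o
  have cfg: "(c X' Y' \<cdot> (f \<boxtimes> g)) \<boxtimes> h = (c X' Y' \<boxtimes> ident (T Z')) \<cdot> ((f \<boxtimes> g) \<boxtimes> h)"
    and cgh: "f \<boxtimes> (c Y' Z' \<cdot> (g \<boxtimes> h)) = (ident (T X') \<boxtimes> c Y' Z') \<cdot> (f \<boxtimes> (g \<boxtimes> h))"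
    using s by (simp_all add: interchange)
  have "TA (\<alpha> X' Y' Z') \<cdot> c (X' \<otimes> Y') Z' \<cdot> ((c X' Y' \<cdot> (f \<boxtimes> g)) \<boxtimes> h) =
      (TA (\<alpha> X' Y' Z') \<cdot> c (X' \<otimes> Y') Z' \<cdot> (c X' Y' \<boxtimes> ident (T Z'))) \<cdot> ((f \<boxtimes> g) \<boxtimes> h)"
    unfolding cfg using s by (simp add: comp_assoc_seq)
  also have "\<dots> = c X' (Y' \<otimes> Z') \<cdot> (ident (T X') \<boxtimes> c Y' Z') \<cdot>
      \<alpha> (T X') (T Y') (T Z') \<cdot> ((f \<boxtimes> g) \<boxtimes> h)"
    using s by (subst c_assoc) (simp_all add: comp_assoc_seq)
  also have "\<alpha> (T X') (T Y') (T Z') \<cdot> ((f \<boxtimes> g) \<boxtimes> h) = (f \<boxtimes> (g \<boxtimes> h)) \<cdot> \<alpha> X Y Z"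
    using assoc_natural[of f X "T X'" g Y "T Y'" h Z "T Z'"] s by (simp add: hom_def)
  also have "c X' (Y' \<otimes> Z') \<cdot> (ident (T X') \<boxtimes> c Y' Z') \<cdot> (f \<boxtimes> (g \<boxtimes> h)) \<cdot> \<alpha> X Y Z =
      (c X' (Y' \<otimes> Z') \<cdot> (f \<boxtimes> (c Y' Z' \<cdot> (g \<boxtimes> h)))) \<cdot> \<alpha> X Y Z"
    unfolding cgh using s by (simp add: comp_assoc_seq)
  finally show ?thesis
    using s by (simp add: comp_pure_left comp_pure_right)
qed

lemma kleisli_lunit_natural:
  assumes "F \<in> hom K X Y"
  shows "lunit\<^bsub>K\<^esub> Y \<cdot>\<^bsub>K\<^esub> (Ident K \<one>\<^bsub>K\<^esub> \<boxtimes>\<^bsub>K\<^esub> F) = F \<cdot>\<^bsub>K\<^esub> lunit\<^bsub>K\<^esub> X"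
proof -
  from assms obtain f where
    s: "F = (f, Y)" "f \<in> Arr C" "Dom C f = X" "Cod C f = T Y" "X \<in> Obj C" "Y \<in> Obj C"
    by (elim kleisli_homE)
  have split: "\<eta> \<one> \<boxtimes> f = (u \<boxtimes> ident (T Y)) \<cdot> (ident \<one> \<boxtimes> f)"
    using s by (simp add: u_eta interchange)
  have "TA (lunit Y) \<cdot> c \<one> Y \<cdot> (\<eta> \<one> \<boxtimes> f) =
      (TA (lunit Y) \<cdot> c \<one> Y \<cdot> (u \<boxtimes> ident (T Y))) \<cdot> (ident \<one> \<boxtimes> f)"
    unfolding split using s by (simp add: u_eta comp_assoc_seq)
  also have "\<dots> = f \<cdot> lunit X"
    using s lunit_natural[of f X "T Y"] by (simp add: c_unit_left hom_def)
  finally show ?thesis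
    using s by (simp add: comp_pure_left comp_pure_right kleisli_ident)
qed

lemma kleisli_runit_natural:
  assumes "F \<in> hom K X Y"
  shows "runit\<^bsub>K\<^esub> Y \<cdot>\<^bsub>K\<^esub> (F \<boxtimes>\<^bsub>K\<^esub> Ident K \<one>\<^bsub>K\<^esub>) = F \<cdot>\<^bsub>K\<^esub> runit\<^bsub>K\<^esub> X"
proof -
  from assms obtain f where
    s: "F = (f, Y)" "f \<in> Arr C" "Dom C f = X" "Cod C f = T Y" "X \<in> Obj C" "Y \<in> Obj C"
    by (elim kleisli_homE)
  have split: "f \<boxtimes> \<eta> \<one> = (ident (T Y) \<boxtimes> u) \<cdot> (f \<boxtimes> ident \<one>)"
    using s by (simp add: u_eta interchange)
  have "TA (runit Y) \<cdot> c Y \<one> \<cdot> (f \<boxtimes> \<eta> \<one>) =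
      (TA (runit Y) \<cdot> c Y \<one> \<cdot> (ident (T Y) \<boxtimes> u)) \<cdot> (f \<boxtimes> ident \<one>)"
    unfolding split using s by (simp add: u_eta comp_assoc_seq)
  also have "\<dots> = f \<cdot> runit X"
    using s runit_natural[of f X "T Y"] by (simp add: c_unit_right hom_def)
  finally show ?thesis
    using s by (simp add: comp_pure_left comp_pure_right kleisli_ident)
qed

lemma kleisli_braid_natural:
  assumes "F \<in> hom K X X'" "G \<in> hom K Y Y'"
  shows "\<gamma>\<^bsub>K\<^esub> X' Y' \<cdot>\<^bsub>K\<^esub> (F \<boxtimes>\<^bsub>K\<^esub> G) = (G \<boxtimes>\<^bsub>K\<^esub> F) \<cdot>\<^bsub>K\<^esub> \<gamma>\<^bsub>K\<^esub> X Y"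
proof -
  from assms obtain f g where
    f: "F = (f, X')" "f \<in> Arr C" "Dom C f = X" "Cod C f = T X'"
    and g: "G = (g, Y')" "g \<in> Arr C" "Dom C g = Y" "Cod C g = T Y'"
    and o: "X \<in> Obj C" "X' \<in> Obj C" "Y \<in> Obj C" "Y' \<in> Obj C"
    by (elim kleisli_homE)
  note s = f g o
  have "TA (\<gamma> X' Y') \<cdot> c X' Y' \<cdot> (f \<boxtimes> g) = (TA (\<gamma> X' Y') \<cdot> c X' Y') \<cdot> (f \<boxtimes> g)"
    using s by (simp add: comp_assoc_seq)
  also have "\<dots> = c Y' X' \<cdot> \<gamma> (T X') (T Y') \<cdot> (f \<boxtimes> g)"
    using s by (simp add: c_braid comp_assoc_seq)
  also have "\<gamma> (T X') (T Y') \<cdot> (f \<boxtimes> g) = (g \<boxtimes> f) \<cdot> \<gamma> X Y"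
    using braid_natural[of f X "T X'" g Y "T Y'"] s by (simp add: hom_def)
  finally show ?thesis
    using s by (simp add: comp_pure_left comp_pure_right comp_assoc_seq)
qed

lemmas pure_simps = pure_comp pure_tensor pure_ident[symmetric] kleisli_inv_arrow

lemma kleisli_sym_mon: "sym_mon_category K"
proof (intro sym_mon_category.intro kleisli_category sym_mon_category_axioms.intro)
  fix F X X' G Y Y' assume "F \<in> hom K X X'" "G \<in> hom K Y Y'"
  then show "F \<boxtimes>\<^bsub>K\<^esub> G \<in> hom K (X \<otimes>\<^bsub>K\<^esub> Y) (X' \<otimes>\<^bsub>K\<^esub> Y')"
    by (elim kleisli_homE) (simp add: kleisli_hom_iff)
next
  fix F X Y assume F: "F \<in> hom K X Y"
  show "lunit\<^bsub>K\<^esub> Y \<cdot>\<^bsub>K\<^esub> (Ident K \<one>\<^bsub>K\<^esub> \<boxtimes>\<^bsub>K\<^esub> F) = F \<cdot>\<^bsub>K\<^esub> lunit\<^bsub>K\<^esub> X"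
    by (rule kleisli_lunit_natural[OF F])
  show "runit\<^bsub>K\<^esub> Y \<cdot>\<^bsub>K\<^esub> (F \<boxtimes>\<^bsub>K\<^esub> Ident K \<one>\<^bsub>K\<^esub>) = F \<cdot>\<^bsub>K\<^esub> runit\<^bsub>K\<^esub> X"
    by (rule kleisli_runit_natural[OF F])
qed (simp_all add: pure_simps pure_hom pure_iso tensor_ident pentagon triangle braid_symmetric hexagon
    assoc_hom lunit_hom runit_hom braid_hom
    kleisli_tensor_comp kleisli_assoc_natural[simplified] kleisli_braid_natural[simplified])

lemma kleisli_middle_swap:
  "X \<in> Obj C \<Longrightarrow> Y \<in> Obj C \<Longrightarrow> middle_swap K X Y = J (middle_swap C X Y)"
  by (simp add: middle_swap_def pure_simps)

lemma kleisli_gs_mon: "gs_mon_category K"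
  by (intro gs_mon_category.intro kleisli_sym_mon gs_mon_category_axioms.intro)
    (simp_all add: pure_simps pure_hom dup_hom disch_hom dup_coassoc dup_counit_left dup_counit_right
      dup_commutative dup_tensor dup_unit disch_tensor disch_unit kleisli_middle_swap)

end


section \<open>Affine monads preserve projections\<close>

theorem proposition3p11:
  fixes C :: "('o, 'a) gs_mon_data"
    and T :: "'o \<Rightarrow> 'o" and TA :: "'a \<Rightarrow> 'a"
    and \<mu> :: "'o \<Rightarrow> 'a" and \<eta> :: "'o \<Rightarrow> 'a"
    and c :: "'o \<Rightarrow> 'o \<Rightarrow> 'a" and u :: "'a"
  assumes "gs_mon_category C"
    and "affine_monad C T TA \<mu> \<eta> c u"
    and "has_projections C"
  shows "has_projections (kleisli C T TA \<mu> \<eta> c)"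
proof -
  interpret affine_monad C T TA \<mu> \<eta> c u by fact
  interpret has_projections C by fact
  interpret gs_mon_monad C T TA \<mu> \<eta> c u by unfold_locales
  show ?thesis
  proof (intro has_projections.intro kleisli_gs_mon has_projections_axioms.intro)
    fix F X Y assume "F \<in> hom K X Y"
    then obtain f where
      s: "F = (f, Y)" "f \<in> Arr C" "Dom C f = X" "Cod C f = T Y" "X \<in> Obj C" "Y \<in> Obj C"
      by (elim kleisli_homE)
    have "TA (bang\<^bsub>C\<^esub> Y) \<cdot>\<^bsub>C\<^esub> f = \<eta> \<one>\<^bsub>C\<^esub> \<cdot>\<^bsub>C\<^esub> bang\<^bsub>C\<^esub> (T Y) \<cdot>\<^bsub>C\<^esub> f"
      using s by (simp add: affine u_eta comp_assoc_seq)
    also have "bang\<^bsub>C\<^esub> (T Y) \<cdot>\<^bsub>C\<^esub> f = bang\<^bsub>C\<^esub> X"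
      using disch_natural[of f X "T Y"] s by (simp add: hom_def)
    finally show "bang\<^bsub>K\<^esub> Y \<cdot>\<^bsub>K\<^esub> F = bang\<^bsub>K\<^esub> X"
      using s comp_pure_left[of f "bang\<^bsub>C\<^esub> Y" Y] by (simp add: kleisli_pure_def)
  qed
qed

end
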